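(* Let $\mathcal{G}$ be a game structure, $\mathcal{U}$ an observation model, and $\mathcal{M}=(\{v\},f^*,\sim,V)$ a certainty epistemic model w.r.t. $\mathcal{G}$. Let $\mathcal{G}^{\upharpoonright f^*(v)}=(S',\frown,R',O')$ be the epistemic game tree generated from $f^*(v)$, let $\mathcal{F}^{\otimes}(\mathcal{M})=(W',\sim',\to,V')$ be the run model generated from $\mathcal{M}$ by repeatedly updating with $\mathcal{U}$, and let $g$ be the tracking function from $\mathcal{F}^{\otimes}(\mathcal{M})$ to $\mathcal{G}^{\upharpoonright f^*(v)}$. Then $\mathcal{U}$ is non-informative w.r.t. $\mathcal{F}^{\otimes}(\mathcal{M})$ if and only if $g$ is an isomorphism from $\mathcal{F}^{\otimes}(\mathcal{M})$ to $\mathcal{G}^{\upharpoonright f^*(v)}$.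
   Context: Fixed data: $I$ is a non-empty finite set of players; $A=\biguplus_{i\in I}A_i$ is a non-empty finite set of actions, the sets $A_i$ being mutually disjoint; $P$ is a finite set of information pieces containing a designated piece $p^a$ for each $a\in A$. Game structure: $\mathcal{G}=(S,R,O)$ where $S$ is a non-empty set of states; $R$ is a partial function $S\times A\to S$ such that if $R(s,a)$ is defined then $\iota(s)=i$ for some $i\in I$, where $\iota(s)=i$ iff $\emptyset\subset\{a\mid R(s,a)\text{ is defined}\}\subseteq A_i$; and $O:S\times I\to 2^P$ is a function such that for all $s\in S$, $i\in I$, $a\in A_i$: $p^a\in O(s,i)$ iff $R(s,a)$ is defined. Write $sR_at$ for $R(s,a)=t$, and $e(s)=\{a\mid R(s,a)\text{ is defined}\}$. Epistemic model w.r.t. $\mathcal{G}$: $\mathcal{M}=(W,f,\sim,V)$ where $W$ is a non-empty set, $f:W\to S$, each $\sim_i$ ($i\in I$) is an equivalence relation on $W$ such that $w\sim_i v$ implies $O(f(w),i)=O(f(v),i)$, and $V:W\times I\to 2^P$ satisfies $V(w,i)=O(f(w),i)$. It is a certainty epistemic model if $W$ is a singleton. Observation model: $\mathcal{U}=(A,\leftrightsquigarrow)$ where each $\leftrightsquigarrow_i$ ($i\in I$) is an equivalence relation on $A$. Update product: $\mathcal{M}\otimes\mathcal{U}=(W',f',\sim',V')$ with $W'=\{(w,a)\mid w\in W, a\in e(f(w))\}$; $f'((w,a))=R(f(w),a)$; $(w,a)\sim'_i(u,b)$ iff $w\sim_i u$, $a\leftrightsquigarrow_i b$ and $O(R(f(w),a),i)=O(R(f(u),b),i)$;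 $V'((w,a),i)=O(R(f(w),a),i)$. $\mathcal{M}\otimes\mathcal{U}^k$ is the $k$-fold iterate (possibly with empty domain), with $\mathcal{M}\otimes\mathcal{U}^0=\mathcal{M}$. Run model: $\mathcal{F}^\otimes(\mathcal{M})=(W,\{\sim_i\}_{i\in I},\{\xrightarrow{a}\}_{a\in A},V)$, where the states are the sequences $(s,a_1,\dots,a_k)$, $k\ge 0$, that exist in $\mathcal{M}\otimes\mathcal{U}^k$ (iterated pairs identified with sequences) and for which $f_{\mathcal{M}}(s)R_{a_1}t_1R_{a_2}\cdots R_{a_k}t_k$ for some game states $t_1,\dots,t_k$; $(s,a_1,\dots,a_k)\sim_i(t,a'_1,\dots,a'_j)$ iff $k=j$ and the two are $\sim_i$-related in $\mathcal{M}\otimes\mathcal{U}^k$; $(s,a_1,\dots,a_k)\xrightarrow{a}(t,a'_1,\dots,a'_j)$ iff $s=t$ and $a'_1\dots a'_j=a_1\dots a_k a$; $V((s,a_1,\dots,a_k),i)=V_{\mathcal{M}\otimes\mathcal{U}^k}((s,a_1,\dots,a_k),i)$. Epistemic game tree generated from $s\in S$ (with perfect recall): $\mathcal{G}^{\upharpoonright s}=(S',\{\frown_i\}_{i\in I},\{R'_a\}_{a\in A},O')$, where $S'=\{(s,a_1,\dots,a_n)\mid n\ge 0,\ sR_{a_1}t_1R_{a_2}\cdots R_{a_n}t_n\text{ for some }t_1,\dots,t_n\in S\}$; $R'_a=\{(w,u)\in S'\times S'\mid u=(w,a)\}$ (i.e. $u$ is $w$ extended by $a$); $O'((s,a_1,\dots,a_n),i)=O(t_n,i)$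 where $t_n$ is the state reached from $s$ by $a_1,\dots,a_n$ ($t_0=s$); and $w\frown_i u$ iff for some $n\ge 0$ there are $a_1,\dots,a_n,b_1,\dots,b_n\in A$ and $w_1,\dots,w_n,u_1,\dots,u_n\in S'$ such that $w=w_n$, $u=u_n$, $(s)R'_{a_1}w_1R'_{a_2}\cdots R'_{a_n}w_n$, $(s)R'_{b_1}u_1R'_{b_2}\cdots R'_{b_n}u_n$ and $O'(w_k,i)=O'(u_k,i)$ for every $1\le k\le n$ (for $n=0$ this means $w=u=(s)$). Tracking function: the (partial) function $g$ from states of $\mathcal{F}^\otimes(\mathcal{M})$ to $S'$ given by $g(w,a_1,\dots,a_n)=(f^*(w),a_1,\dots,a_n)$, where $f^*$ is the state assignment of $\mathcal{M}$; it is defined exactly on those states with $f^*(w)=s$. Non-informative: $\mathcal{U}$ is non-informative w.r.t. $\mathcal{F}^\otimes(\mathcal{M})=(W',\sim',\to,V')$ if for all $w,u,s,t\in W'$, $a,b\in A$, $i\in I$ such that $w\xrightarrow{a}s$, $u\xrightarrow{b}t$ and $w\sim'_iu$: if not $a\leftrightsquigarrow_i b$, then $V'(s,i)\neq V'(t,i)$. Isomorphism: a (total) bijection between the state sets that preserves and reflects the epistemic relations ($\sim'_i$ versus $\frown_i$) and the transitions ($\xrightarrow{a}$ versus $R'_a$) and satisfies $V'(w,i)=O'(g(w),i)$. *)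

theory Defs
  imports Main "HOL-Library.Disjoint_Sets"
begin

section \<open>Game structures\<close>

text \<open>
  Players, actions, information pieces, game states and possible worlds all live in explicit
  carrier sets. \<open>Act i\<close> is the set of actions of player \<open>i\<close>, and \<open>pc a\<close> is the information
  piece designated for the action \<open>a\<close>.
\<close>

locale game_frame =
  fixes I :: "'i set" and Act :: "'i \<Rightarrow> 'a set" and P :: "'p set" and pc :: "'a \<Rightarrow> 'p"
  assumes players: "I \<noteq> {}" "finite I"
    and acts: "(\<Union>i\<in>I. Act i) \<noteq> {}" "finite (\<Union>i\<in>I. Act i)" "disjoint_family_on Act I"
    and pieces: "finite P" "\<And>a. a \<in> (\<Union>i\<in>I. Act i) \<Longrightarrow> pc a \<in> P"

record ('s, 'a, 'i, 'p) game =
  states :: "'s set"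
  trans :: "'s \<Rightarrow> 'a \<Rightarrow> 's option"
  obs :: "'s \<Rightarrow> 'i \<Rightarrow> 'p set"

definition enabled :: "('s, 'a, 'i, 'p) game \<Rightarrow> 's \<Rightarrow> 'a set" where
  "enabled G s = {a. trans G s a \<noteq> None}"

text \<open>\<open>turn Act G s i\<close> says that \<open>\<iota>(s) = i\<close>.\<close>

definition turn :: "('i \<Rightarrow> 'a set) \<Rightarrow> ('s, 'a, 'i, 'p) game \<Rightarrow> 's \<Rightarrow> 'i \<Rightarrow> bool" where
  "turn Act G s i \<longleftrightarrow> {} \<subset> enabled G s \<and> enabled G s \<subseteq> Act i"

locale game_structure = game_frame I Act P pc
  for I :: "'i set" and Act :: "'i \<Rightarrow> 'a set" and P :: "'p set" and pc :: "'a \<Rightarrow> 'p" +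
  fixes G :: "('s, 'a, 'i, 'p) game"
  assumes states_nonempty: "states G \<noteq> {}"
    and trans_closed:
      "\<And>s a t. trans G s a = Some t \<Longrightarrow> s \<in> states G \<and> a \<in> (\<Union>i\<in>I. Act i) \<and> t \<in> states G"
    and trans_turn: "\<And>s a. trans G s a \<noteq> None \<Longrightarrow> \<exists>i\<in>I. turn Act G s i"
    and obs_pieces: "\<And>s i. s \<in> states G \<Longrightarrow> i \<in> I \<Longrightarrow> obs G s i \<subseteq> P"
    and obs_act: "\<And>s i a. s \<in> states G \<Longrightarrow> i \<in> I \<Longrightarrow> a \<in> Act i \<Longrightarrow>
      pc a \<in> obs G s i \<longleftrightarrow> trans G s a \<noteq> None"

text \<open>
  \<open>reach G s [a\<^sub>1, \<dots>, a\<^sub>n] = Some t\<close> iff there are \<open>t\<^sub>1, \<dots>, t\<^sub>n\<close> with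
  \<open>s R\<^bsub>a\<^sub>1\<^esub> t\<^sub>1 R\<^bsub>a\<^sub>2\<^esub> \<dots> R\<^bsub>a\<^sub>n\<^esub> t\<^sub>n\<close> and \<open>t\<close> is the last state of this play (\<open>t = s\<close> if \<open>n = 0\<close>).
\<close>

fun reach :: "('s, 'a, 'i, 'p) game \<Rightarrow> 's \<Rightarrow> 'a list \<Rightarrow> 's option" where
  "reach G s [] = Some s"
| "reach G s (a # as) = Option.bind (trans G s a) (\<lambda>t. reach G t as)"

section \<open>Epistemic models and update product\<close>

record ('w, 's, 'i, 'p) model =
  worlds :: "'w set"
  assign :: "'w \<Rightarrow> 's"
  indist :: "'i \<Rightarrow> ('w \<times> 'w) set"
  val :: "'w \<Rightarrow> 'i \<Rightarrow> 'p set"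

definition epistemic_model ::
    "'i set \<Rightarrow> ('s, 'a, 'i, 'p) game \<Rightarrow> ('w, 's, 'i, 'p) model \<Rightarrow> bool" where
  "epistemic_model I G M \<longleftrightarrow>
     worlds M \<noteq> {} \<and>
     (\<forall>w\<in>worlds M. assign M w \<in> states G) \<and>
     (\<forall>i\<in>I. equiv (worlds M) (indist M i)) \<and>
     (\<forall>i\<in>I. \<forall>w v. (w, v) \<in> indist M i \<longrightarrow> obs G (assign M w) i = obs G (assign M v) i) \<and>
     (\<forall>w\<in>worlds M. \<forall>i\<in>I. val M w i = obs G (assign M w) i)"

definition certainty_epistemic_model ::
    "'i set \<Rightarrow> ('s, 'a, 'i, 'p) game \<Rightarrow> ('w, 's, 'i, 'p) model \<Rightarrow> bool" where
  "certainty_epistemic_model I G M \<longleftrightarrow> epistemic_model I G M \<and> (\<exists>v. worlds M = {v})"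

text \<open>An observation model is given by its family of relations; \<open>A\<close> is the set of all actions.\<close>

definition observation_model :: "'i set \<Rightarrow> 'a set \<Rightarrow> ('i \<Rightarrow> ('a \<times> 'a) set) \<Rightarrow> bool" where
  "observation_model I A U \<longleftrightarrow> (\<forall>i\<in>I. equiv A (U i))"

definition update_product ::
    "('s, 'a, 'i, 'p) game \<Rightarrow> ('w, 's, 'i, 'p) model \<Rightarrow> ('i \<Rightarrow> ('a \<times> 'a) set) \<Rightarrow>
     ('w \<times> 'a, 's, 'i, 'p) model" where
  "update_product G M U =
     (let W = {(w, a). w \<in> worlds M \<and> a \<in> enabled G (assign M w)};
          f = (\<lambda>(w, a). the (trans G (assign M w) a))
      in \<lparr> worlds = W,
           assign = f,
           indist = (\<lambda>i. {((w, a), (u, b)). (w, a) \<in> W \<and> (u, b) \<in> W \<and>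
                       (w, u) \<in> indist M i \<and> (a, b) \<in> U i \<and>
                       obs G (f (w, a)) i = obs G (f (u, b)) i}),
           val = (\<lambda>x i. obs G (f x) i) \<rparr>)"

text \<open>
  Each product changes the type of worlds from \<open>'w\<close> to \<open>'w \<times> 'a\<close>. To iterate it, worlds are
  identified with sequences \<open>(w, [a\<^sub>1, \<dots>, a\<^sub>k])\<close>, by transporting the model along the injective
  maps \<open>w \<mapsto> (w, [])\<close> and \<open>((w, as), a) \<mapsto> (w, as @ [a])\<close>.
\<close>

definition rename_worlds ::
    "('w \<Rightarrow> 'x) \<Rightarrow> ('w, 's, 'i, 'p) model \<Rightarrow> ('x, 's, 'i, 'p) model" where
  "rename_worlds h M =
     \<lparr> worlds = h ` worlds M,
       assign = assign M \<circ> inv_into (worlds M) h,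
       indist = (\<lambda>i. map_prod h h ` indist M i),
       val = val M \<circ> inv_into (worlds M) h \<rparr>"

definition snoc :: "('w \<times> 'a list) \<times> 'a \<Rightarrow> 'w \<times> 'a list" where
  "snoc = (\<lambda>((w, as), a). (w, as @ [a]))"

fun iterated_product ::
    "('s, 'a, 'i, 'p) game \<Rightarrow> ('w, 's, 'i, 'p) model \<Rightarrow> ('i \<Rightarrow> ('a \<times> 'a) set) \<Rightarrow> nat \<Rightarrow>
     ('w \<times> 'a list, 's, 'i, 'p) model" where
  "iterated_product G M U 0 = rename_worlds (\<lambda>w. (w, [])) M"
| "iterated_product G M U (Suc k) =
     rename_worlds snoc (update_product G (iterated_product G M U k) U)"

section \<open>Run models and epistemic game trees\<close>

text \<open>The common shape of run models and epistemic game trees.\<close>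

record ('x, 'i, 'a, 'p) epistemic_ts =
  nodes :: "'x set"
  epist :: "'i \<Rightarrow> ('x \<times> 'x) set"
  step :: "'a \<Rightarrow> ('x \<times> 'x) set"
  info :: "'x \<Rightarrow> 'i \<Rightarrow> 'p set"

definition run_model ::
    "('s, 'a, 'i, 'p) game \<Rightarrow> ('w, 's, 'i, 'p) model \<Rightarrow> ('i \<Rightarrow> ('a \<times> 'a) set) \<Rightarrow>
     ('w \<times> 'a list, 'i, 'a, 'p) epistemic_ts" where
  "run_model G M U =
     (let N = {(w, as). (w, as) \<in> worlds (iterated_product G M U (length as)) \<and>
                 reach G (assign M w) as \<noteq> None}
      in \<lparr> nodes = N,
           epist = (\<lambda>i. {((w, as), (u, bs)). (w, as) \<in> N \<and> (u, bs) \<in> N \<and>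
                      length as = length bs \<and>
                      ((w, as), (u, bs)) \<in> indist (iterated_product G M U (length as)) i}),
           step = (\<lambda>a. {((w, as), (u, bs)). (w, as) \<in> N \<and> (u, bs) \<in> N \<and>
                     w = u \<and> bs = as @ [a]}),
           info = (\<lambda>(w, as) i. val (iterated_product G M U (length as)) (w, as) i) \<rparr>)"

text \<open>
  In the indistinguishability relation of the game tree, the two chains of histories
  \<open>w\<^sub>1, \<dots>, w\<^sub>n\<close> and \<open>u\<^sub>1, \<dots>, u\<^sub>n\<close> are the lists \<open>ws\<close> and \<open>us\<close>; prefixing the root shifts indices
  by one.
\<close>

definition game_tree ::
    "('s, 'a, 'i, 'p) game \<Rightarrow> 's \<Rightarrow> ('s \<times> 'a list, 'i, 'a, 'p) epistemic_ts" where
  "game_tree G s =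
     (let N = {(s, as) | as. reach G s as \<noteq> None};
          stp = (\<lambda>a. {((t, as), (u, bs)). (t, as) \<in> N \<and> (u, bs) \<in> N \<and> u = t \<and> bs = as @ [a]});
          inf = (\<lambda>(t, as) i. obs G (the (reach G t as)) i);
          chain = (\<lambda>as ws. length ws = length as \<and> set ws \<subseteq> N \<and>
                     (\<forall>k<length as. (((s, []) # ws) ! k, ws ! k) \<in> stp (as ! k)))
      in \<lparr> nodes = N,
           epist = (\<lambda>i. {(w, u). \<exists>as bs ws us.
                      length as = length bs \<and> chain as ws \<and> chain bs us \<and>
                      w = last ((s, []) # ws) \<and> u = last ((s, []) # us) \<and>
                      (\<forall>k<length as. inf (ws ! k) i = inf (us ! k) i)}),
           step = stp,
           info = inf \<rparr>)"

definition tracking_function ::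
    "('s, 'a, 'i, 'p) game \<Rightarrow> ('w, 's, 'i, 'p) model \<Rightarrow> ('i \<Rightarrow> ('a \<times> 'a) set) \<Rightarrow> 's \<Rightarrow>
     'w \<times> 'a list \<Rightarrow> ('s \<times> 'a list) option" where
  "tracking_function G M U s = (\<lambda>(w, as).
     if (w, as) \<in> nodes (run_model G M U) \<and> assign M w = s then Some (assign M w, as) else None)"

definition non_informative ::
    "'i set \<Rightarrow> 'a set \<Rightarrow> ('i \<Rightarrow> ('a \<times> 'a) set) \<Rightarrow> ('x, 'i, 'a, 'p) epistemic_ts \<Rightarrow> bool" where
  "non_informative I A U F \<longleftrightarrow>
     (\<forall>w\<in>nodes F. \<forall>u\<in>nodes F. \<forall>s\<in>nodes F. \<forall>t\<in>nodes F. \<forall>a\<in>A. \<forall>b\<in>A. \<forall>i\<in>I.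
        (w, s) \<in> step F a \<and> (u, t) \<in> step F b \<and> (w, u) \<in> epist F i \<longrightarrow>
        (a, b) \<notin> U i \<longrightarrow> info F s i \<noteq> info F t i)"

definition ets_isomorphism ::
    "'i set \<Rightarrow> 'a set \<Rightarrow> ('x, 'i, 'a, 'p) epistemic_ts \<Rightarrow> ('y, 'i, 'a, 'p) epistemic_ts \<Rightarrow>
     ('x \<Rightarrow> 'y option) \<Rightarrow> bool" where
  "ets_isomorphism I A F T g \<longleftrightarrow>
     dom g = nodes F \<and>
     bij_betw (\<lambda>x. the (g x)) (nodes F) (nodes T) \<and>
     (\<forall>i\<in>I. \<forall>x\<in>nodes F. \<forall>y\<in>nodes F.
        (x, y) \<in> epist F i \<longleftrightarrow> (the (g x), the (g y)) \<in> epist T i) \<and>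
     (\<forall>a\<in>A. \<forall>x\<in>nodes F. \<forall>y\<in>nodes F.
        (x, y) \<in> step F a \<longleftrightarrow> (the (g x), the (g y)) \<in> step T a) \<and>
     (\<forall>i\<in>I. \<forall>x\<in>nodes F. info F x i = info T (the (g x)) i)"

end

theory Submission
  imports Defs
begin

text \<open>
  Over a certainty model, both the run model and the game tree have the plays from the initial
  state as their nodes, so the tracking function is bijective and respects steps and information
  for any observation model. Both indistinguishability relations unfold along the last action:
  the game tree requires equal observations after it, the run model in addition that the two
  last actions be observationally equivalent. Non-informativeness says that this additional
  requirement is redundant.
\<close>

section \<open>Plays of the game, extended and cut at the end\<close>

lemma reach_snoc:
  "reach G s (as @ [a]) = Option.bind (reach G s as) (\<lambda>t. trans G t a)"
  by (induction as arbitrary: s) (auto split: bind_split)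

lemma reach_take:
  assumes "reach G s as \<noteq> None"
  shows "reach G s (take k as) \<noteq> None"
  using assms by (induction as arbitrary: s k) (auto simp: take_Cons split: bind_splits nat.splits)

lemma reach_snocD:
  assumes "reach G s (as @ [a]) = Some t"
  shows "\<exists>u. reach G s as = Some u"
  using assms by (auto simp: reach_snoc split: bind_splits)

text \<open>\<open>non_informative\<close> quantifies only over actions of players, so the actions
  occurring in a play have to be placed in that set before it can be applied.\<close>

lemma (in game_structure) reach_actions:
  assumes "reach G s as \<noteq> None"
  shows "set as \<subseteq> (\<Union>i\<in>I. Act i)"
  using assms
  by (induction as arbitrary: s) (auto dest: trans_closed split: bind_splits)

section \<open>Renaming worlds to sequences\<close>

lemma rename_worlds_simps:
  assumes "inj h"
  shows "worlds (rename_worlds h M) = h ` worlds M"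
    and "w \<in> worlds M \<Longrightarrow> assign (rename_worlds h M) (h w) = assign M w"
    and "w \<in> worlds M \<Longrightarrow> val (rename_worlds h M) (h w) = val M w"
    and "(h w, h u) \<in> indist (rename_worlds h M) i \<longleftrightarrow> (w, u) \<in> indist M i"
  \<comment> \<open>\<open>inv_into (worlds M) h\<close> undoes \<open>h\<close> only on
    \<open>worlds M\<close>, whence the membership premises for \<open>assign\<close> and
    \<open>val\<close>; the relation is transported by image, so injectivity alone suffices for
    it.\<close>
  using assms unfolding rename_worlds_def
  by (auto simp: inj_on_subset inj_eq inv_into_f_f)

lemma inj_snoc: "inj snoc"
  by (auto simp: inj_def snoc_def)

lemma snoc_apply [simp]: "snoc ((w, as), a) = (w, as @ [a])"
  by (simp add: snoc_def)

lemma snoc_mem_image: "(w, as @ [a]) \<in> snoc ` X \<longleftrightarrow> ((w, as), a) \<in> X"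
  using inj_image_mem_iff[OF inj_snoc, of "((w, as), a)" X] by simp

lemma inj_empty_sequence: "inj (\<lambda>w. (w, []))"
  by (simp add: inj_def)

section \<open>The iterated update product\<close>

lemma update_product_simps:
  "(w, a) \<in> worlds (update_product G M U) \<longleftrightarrow> w \<in> worlds M \<and> trans G (assign M w) a \<noteq> None"
  "assign (update_product G M U) (w, a) = the (trans G (assign M w) a)"
  "val (update_product G M U) x i = obs G (assign (update_product G M U) x) i"
  "((w, a), (u, b)) \<in> indist (update_product G M U) i \<longleftrightarrow>
     (w, a) \<in> worlds (update_product G M U) \<and> (u, b) \<in> worlds (update_product G M U) \<and>
     (w, u) \<in> indist M i \<and> (a, b) \<in> U i \<and>
     obs G (assign (update_product G M U) (w, a)) i = obs G (assign (update_product G M U) (u, b)) i"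
  by (simp_all add: update_product_def Let_def enabled_def)

text \<open>The two claims need a common induction: which sequences survive stage
  \<open>Suc k\<close> depends on the actions enabled at the states assigned in stage
  \<open>k\<close>.\<close>

lemma iterated_product_worlds:
  "worlds (iterated_product G M U k) =
     {(w, as). w \<in> worlds M \<and> length as = k \<and> reach G (assign M w) as \<noteq> None}"
  "(w, as) \<in> worlds (iterated_product G M U k) \<Longrightarrow>
     assign (iterated_product G M U k) (w, as) = the (reach G (assign M w) as)"
proof (induction k arbitrary: w as)
  case 0
  {
    case 1
    show ?case by (auto simp: rename_worlds_def)
  next
    case 2
    then show ?case
      by (auto simp: rename_worlds_simps[OF inj_empty_sequence])
  }
next
  case (Suc k)
  let ?N = "iterated_product G M U k"
  \<comment> \<open>By the induction hypothesis the state assigned to \<open>(w, as)\<close> is the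
    end of the play \<open>as\<close>, so enabledness of \<open>a\<close> there is exactly what
    \<open>reach_snoc\<close> asks for.\<close>
  have upd: "((w, as), a) \<in> worlds (update_product G ?N U) \<longleftrightarrow>
      w \<in> worlds M \<and> length as = k \<and> reach G (assign M w) (as @ [a]) \<noteq> None" for w as a
    using Suc.IH(1) Suc.IH(2)[of w as]
    by (auto simp: update_product_simps reach_snoc split: bind_splits)
  {
    case 1
    have "(w, bs) \<in> worlds (iterated_product G M U (Suc k)) \<longleftrightarrow>
        w \<in> worlds M \<and> length bs = Suc k \<and> reach G (assign M w) bs \<noteq> None" for w bs
    proof (cases bs rule: rev_cases)
      case Nil
      then show ?thesis
        by (auto simp: rename_worlds_simps[OF inj_snoc])
    next
      case (snoc as a)
      then show ?thesis
        by (simp add: rename_worlds_simps[OF inj_snoc] snoc_mem_image upd)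
    qed
    then show ?case by auto
  next
    case 2
    then obtain bs a where x: "as = bs @ [a]" "((w, bs), a) \<in> worlds (update_product G ?N U)"
      by (auto simp: rename_worlds_simps[OF inj_snoc])
    have "assign (iterated_product G M U (Suc k)) (w, as) =
        assign (update_product G ?N U) ((w, bs), a)"
      using rename_worlds_simps(2)[OF inj_snoc x(2)] by (simp add: x(1))
    also have "\<dots> = the (reach G (assign M w) as)"
      using x upd[of w bs a] Suc.IH(1) Suc.IH(2)[of w bs]
      by (auto simp: update_product_simps reach_snoc split: bind_splits)
    finally show ?case .
  }
qed

text \<open>From the first product on, the valuation is read off the assigned state. Stage zero is
  different: there it is the valuation of \<open>M\<close> itself, tied to \<open>obs\<close> only
  by \<open>epistemic_model\<close>.\<close>

lemma iterated_product_val_Suc: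
  assumes "(w, as) \<in> worlds (iterated_product G M U (Suc k))"
  shows "val (iterated_product G M U (Suc k)) (w, as) i = obs G (the (reach G (assign M w) as)) i"
proof -
  obtain bs a where x: "as = bs @ [a]"
    "((w, bs), a) \<in> worlds (update_product G (iterated_product G M U k) U)"
    using assms by (auto simp: rename_worlds_simps[OF inj_snoc])
  have "val (iterated_product G M U (Suc k)) (w, as) i =
      obs G (assign (update_product G (iterated_product G M U k) U) ((w, bs), a)) i"
    using rename_worlds_simps(3)[OF inj_snoc x(2)]
    by (simp add: x(1)) (simp add: update_product_simps)
  also have "assign (update_product G (iterated_product G M U k) U) ((w, bs), a) =
      assign (iterated_product G M U (Suc k)) (w, as)"
    using rename_worlds_simps(2)[OF inj_snoc x(2)] by (simp add: x(1))
  finally show ?thesis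
    by (simp only: iterated_product_worlds(2)[OF assms])
qed

section \<open>The run model in terms of plays\<close>

lemma run_model_nodes:
  "(w, as) \<in> nodes (run_model G M U) \<longleftrightarrow> w \<in> worlds M \<and> reach G (assign M w) as \<noteq> None"
  by (auto simp: run_model_def iterated_product_worlds(1))

lemma run_model_step:
  "((w, as), (u, bs)) \<in> step (run_model G M U) a \<longleftrightarrow>
     (u, bs) \<in> nodes (run_model G M U) \<and> u = w \<and> bs = as @ [a]"
  by (auto simp: run_model_def Let_def iterated_product_worlds(1) dest: reach_snocD)

lemma run_model_info:
  assumes "epistemic_model I G M" "i \<in> I" "(w, as) \<in> nodes (run_model G M U)"
  shows "info (run_model G M U) (w, as) i = obs G (the (reach G (assign M w) as)) i"
proof (cases "length as")
  case 0
  moreover have "w \<in> worlds M"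
    using assms(3) by (simp add: run_model_nodes)
  ultimately show ?thesis
    using assms(1,2)
    by (simp add: run_model_def Let_def epistemic_model_def
        rename_worlds_simps(3)[OF inj_empty_sequence])
next
  case (Suc k)
  then have "(w, as) \<in> worlds (iterated_product G M U (Suc k))"
    using assms(3) unfolding run_model_nodes iterated_product_worlds(1) by simp
  from iterated_product_val_Suc[OF this, of i] Suc show ?thesis
    by (simp add: run_model_def Let_def del: iterated_product.simps)
qed

lemma run_model_epist_length:
  "((w, as), (u, bs)) \<in> epist (run_model G M U) i \<Longrightarrow> length as = length bs"
  by (auto simp: run_model_def Let_def)

lemma run_model_epist_Nil:
  assumes "epistemic_model I G M" "i \<in> I"
  shows "((w, []), (u, [])) \<in> epist (run_model G M U) i \<longleftrightarrow> (w, u) \<in> indist M i"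
proof -
  \<comment> \<open>An equivalence on the worlds relates only worlds, so the node conditions built
    into \<open>epist\<close> follow from \<open>(w, u) \<in> indist M i\<close>.\<close>
  have "indist M i \<subseteq> worlds M \<times> worlds M"
    using assms by (auto simp: epistemic_model_def equiv_def refl_on_def)
  then show ?thesis
    using rename_worlds_simps(4)[OF inj_empty_sequence, of w u M i]
    by (auto simp: run_model_def Let_def rename_worlds_simps(1)[OF inj_empty_sequence])
qed

text \<open>Peels off one update product. The conjunct \<open>(a, b) \<in> U i\<close> is the only
  difference from the recursion \<open>game_tree_epist_snoc\<close> of the tree.\<close>

lemma run_model_epist_snoc:
  "((w, as @ [a]), (u, bs @ [b])) \<in> epist (run_model G M U) i \<longleftrightarrow>
     (w, as @ [a]) \<in> nodes (run_model G M U) \<and> (u, bs @ [b]) \<in> nodes (run_model G M U) \<and>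
     ((w, as), (u, bs)) \<in> epist (run_model G M U) i \<and> (a, b) \<in> U i \<and>
     obs G (the (reach G (assign M w) (as @ [a]))) i = obs G (the (reach G (assign M u) (bs @ [b]))) i"
  (is "?L \<longleftrightarrow> ?wa \<and> ?ub \<and> ?E \<and> ?U \<and> ?O")
proof (cases "length as = length bs \<and> ?wa \<and> ?ub")
  case False
  then show ?thesis
    by (auto simp: run_model_def Let_def)
next
  case True
  let ?K = "iterated_product G M U (length as)"
  let ?D = "update_product G ?K U"
  have nodes: "(w, as) \<in> nodes (run_model G M U)" "(u, bs) \<in> nodes (run_model G M U)"
    using True by (auto simp: run_model_nodes dest: reach_snocD)
  have inK: "(w, as) \<in> worlds ?K" "(u, bs) \<in> worlds ?K"
    using True nodes unfolding run_model_nodes iterated_product_worlds(1) by auto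
  have inD: "((w, as), a) \<in> worlds ?D" "((u, bs), b) \<in> worlds ?D"
    using inK True
    by (auto simp: update_product_simps iterated_product_worlds(2) run_model_nodes reach_snoc
        split: bind_splits)
  have "?L \<longleftrightarrow> ((w, as @ [a]), (u, bs @ [b])) \<in> indist (iterated_product G M U (Suc (length as))) i"
    using True by (auto simp: run_model_def Let_def)
  also have "\<dots> \<longleftrightarrow> (((w, as), a), ((u, bs), b)) \<in> indist ?D i"
    using rename_worlds_simps(4)[OF inj_snoc, of "((w, as), a)" "((u, bs), b)" ?D i]
    by simp
  also have "\<dots> \<longleftrightarrow> ((w, as), (u, bs)) \<in> indist ?K i \<and> ?U \<and> ?O"
    using inD inK True
    by (auto simp: update_product_simps iterated_product_worlds(2) reach_snoc run_model_nodes
        split: bind_splits)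
  also have "((w, as), (u, bs)) \<in> indist ?K i \<longleftrightarrow> ?E"
    using nodes True by (auto simp: run_model_def Let_def)
  finally show ?thesis
    using True by blast
qed

section \<open>The epistemic game tree in terms of plays\<close>

lemma game_tree_nodes:
  "(t, as) \<in> nodes (game_tree G s) \<longleftrightarrow> t = s \<and> reach G s as \<noteq> None"
  by (simp add: game_tree_def Let_def)

lemma game_tree_step:
  "((t, as), (u, bs)) \<in> step (game_tree G s) a \<longleftrightarrow>
     (u, bs) \<in> nodes (game_tree G s) \<and> u = t \<and> bs = as @ [a]"
  by (auto simp: game_tree_def Let_def dest: reach_snocD)

lemma game_tree_info:
  "info (game_tree G s) (t, as) i = obs G (the (reach G t as)) i"
  by (simp add: game_tree_def Let_def)

text \<open>Each step appends exactly the prescribed action, so a chain from the root is determined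
  by its actions: its entries are the non-empty prefixes. Quantifying over chains thereby reduces to
  quantifying over plays.\<close>

lemma game_tree_chain_iff:
  "length ws = length as \<and> set ws \<subseteq> nodes (game_tree G s) \<and>
     (\<forall>k<length as. (((s, []) # ws) ! k, ws ! k) \<in> step (game_tree G s) (as ! k)) \<longleftrightarrow>
   reach G s as \<noteq> None \<and> ws = map (\<lambda>k. (s, take (Suc k) as)) [0..<length as]"
  (is "?L \<longleftrightarrow> ?R")
proof
  assume L: ?L
  have ws: "ws ! k = (s, take (Suc k) as)" if "k < length as" for k
    using that
  proof (induction k)
    case 0
    then show ?case
      using L by (cases "ws ! 0") (force simp: game_tree_step take_Suc_conv_app_nth)
  next
    case (Suc k)
    then show ?case
      using L by (cases "ws ! Suc k") (force simp: game_tree_step take_Suc_conv_app_nth)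
  qed
  have "reach G s as \<noteq> None"
  proof (cases as rule: rev_cases)
    \<comment> \<open>The last entry of the chain carries all of \<open>as\<close>; being a node, it
      witnesses the play.\<close>
    case (snoc bs b)
    then have "ws ! length bs \<in> nodes (game_tree G s)"
      using L by (metis length_append_singleton lessI nth_mem subsetD)
    then show ?thesis
      using ws[of "length bs"] snoc by (simp add: game_tree_nodes)
  qed simp
  moreover have "ws = map (\<lambda>k. (s, take (Suc k) as)) [0..<length as]"
    using L ws by (intro nth_equalityI) auto
  ultimately show ?R by blast
next
  assume R: ?R
  \<comment> \<open>With the root in front, entry \<open>k\<close> has \<open>k\<close> actions,
    whereas \<open>ws ! k\<close> has \<open>Suc k\<close>.\<close>
  then have "((s, []) # ws) ! k = (s, take k as)" if "k < length as" for k
    using that by (cases k) auto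
  with R show ?L
    by (auto simp: game_tree_step game_tree_nodes take_Suc_conv_app_nth[symmetric] reach_take
        simp del: not_None_eq)
qed

lemma game_tree_epist:
  fixes G :: "('s, 'a, 'i, 'p) game"
  shows "((t, as), (u, bs)) \<in> epist (game_tree G s) i \<longleftrightarrow>
     (t, as) \<in> nodes (game_tree G s) \<and> (u, bs) \<in> nodes (game_tree G s) \<and> length as = length bs \<and>
     (\<forall>k<length as. obs G (the (reach G s (take (Suc k) as))) i =
        obs G (the (reach G s (take (Suc k) bs))) i)"
proof -
  \<comment> \<open>The unique chain provided by \<open>game_tree_chain_iff\<close>; the root put in
    front of it makes \<open>last\<close> correct for the empty history too.\<close>
  define hist where "hist as = map (\<lambda>k. (s, take (Suc k) as)) [0..<length as]" for as :: "'a list"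
  have last: "last ((s, []) # hist cs) = (s, cs)" for cs
    by (cases cs rule: rev_cases) (auto simp: hist_def)
  \<comment> \<open>The definition, refolded into \<open>nodes\<close> and \<open>step\<close> so
    that \<open>game_tree_chain_iff\<close> applies as a rewrite rule to both chains.\<close>
  have "(x, y) \<in> epist (game_tree G s) i \<longleftrightarrow>
      (\<exists>as bs ws us. length as = length bs \<and>
        (length ws = length as \<and> set ws \<subseteq> nodes (game_tree G s) \<and>
          (\<forall>k<length as. (((s, []) # ws) ! k, ws ! k) \<in> step (game_tree G s) (as ! k))) \<and>
        (length us = length bs \<and> set us \<subseteq> nodes (game_tree G s) \<and>
          (\<forall>k<length bs. (((s, []) # us) ! k, us ! k) \<in> step (game_tree G s) (bs ! k))) \<and>
        x = last ((s, []) # ws) \<and> y = last ((s, []) # us) \<and>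
        (\<forall>k<length as. info (game_tree G s) (ws ! k) i = info (game_tree G s) (us ! k) i))"
    for x y
    by (simp add: game_tree_def Let_def)
  then have "(x, y) \<in> epist (game_tree G s) i \<longleftrightarrow>
      (\<exists>as bs. length as = length bs \<and> reach G s as \<noteq> None \<and> reach G s bs \<noteq> None \<and>
        x = (s, as) \<and> y = (s, bs) \<and>
        (\<forall>k<length as. info (game_tree G s) (hist as ! k) i = info (game_tree G s) (hist bs ! k) i))"
    for x y
    unfolding game_tree_chain_iff hist_def[symmetric]
    by (auto simp: last simp del: last.simps)
  then show ?thesis
    by (auto simp: game_tree_nodes game_tree_info hist_def)
qed

lemma game_tree_epist_snoc:
  "((s, as @ [a]), (s, bs @ [b])) \<in> epist (game_tree G s) i \<longleftrightarrow>
     (s, as @ [a]) \<in> nodes (game_tree G s) \<and> (s, bs @ [b]) \<in> nodes (game_tree G s) \<and>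
     ((s, as), (s, bs)) \<in> epist (game_tree G s) i \<and>
     obs G (the (reach G s (as @ [a]))) i = obs G (the (reach G s (bs @ [b]))) i"
  \<comment> \<open>\<open>less_Suc_eq\<close> separates the index \<open>length as\<close>, which
    gives the new observation, from the smaller ones, whose prefixes do not contain the last
    action.\<close>
  by (auto simp: game_tree_epist game_tree_nodes less_Suc_eq dest: reach_snocD)

section \<open>Non-informativeness against agreement of the two epistemic relations\<close>

theorem theorem15:
  fixes I :: "'i set" and Act :: "'i \<Rightarrow> 'a set" and P :: "'p set" and pc :: "'a \<Rightarrow> 'p"
    and G :: "('s, 'a, 'i, 'p) game"
    and U :: "'i \<Rightarrow> ('a \<times> 'a) set"
    and M :: "('w, 's, 'i, 'p) model" and v :: 'w
  assumes "game_structure I Act P pc G"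
    and "observation_model I (\<Union>i\<in>I. Act i) U"
    and "certainty_epistemic_model I G M"
    and "worlds M = {v}"
  shows "non_informative I (\<Union>i\<in>I. Act i) U (run_model G M U) \<longleftrightarrow>
    ets_isomorphism I (\<Union>i\<in>I. Act i) (run_model G M U) (game_tree G (assign M v))
      (tracking_function G M U (assign M v))"
proof -
  let ?A = "\<Union>i\<in>I. Act i" and ?F = "run_model G M U" and ?s = "assign M v"
  let ?T = "game_tree G ?s" and ?g = "tracking_function G M U ?s"
  interpret game_structure I Act P pc G by fact
  have M: "epistemic_model I G M"
    using assms(3) by (simp add: certainty_epistemic_model_def)
  have nodes: "(w, as) \<in> nodes ?F \<longleftrightarrow> w = v \<and> reach G ?s as \<noteq> None" for w as
    by (auto simp: run_model_nodes assms(4))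
  have g: "?g (v, as) = Some (?s, as)" if "reach G ?s as \<noteq> None" for as
    using that nodes by (simp add: tracking_function_def)
  have dom: "dom ?g = nodes ?F"
    by (auto simp: tracking_function_def dom_def nodes split: if_splits)
  \<comment> \<open>The inverse replaces the root state by \<open>v\<close>, the only world of
    \<open>M\<close>.\<close>
  have bij: "bij_betw (\<lambda>x. the (?g x)) (nodes ?F) (nodes ?T)"
    by (rule bij_betw_byWitness[where f' = "\<lambda>(t, as). (v, as)"])
      (auto simp: nodes game_tree_nodes g)
  have stp: "(x, y) \<in> step ?F a \<longleftrightarrow> (the (?g x), the (?g y)) \<in> step ?T a"
    if "x \<in> nodes ?F" "y \<in> nodes ?F" for x y a
    using that by (cases x; cases y) (auto simp: nodes g run_model_step game_tree_step game_tree_nodes)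
  have inf: "info ?F (v, as) i = obs G (the (reach G ?s as)) i"
    if "i \<in> I" "reach G ?s as \<noteq> None" for as i
    using that run_model_info[OF M] nodes by blast
  \<comment> \<open>The one clause of the isomorphism that can fail, stated on action sequences; all
    others are established independently of it.\<close>
  define agree where "agree \<longleftrightarrow> (\<forall>i\<in>I. \<forall>as bs. reach G ?s as \<noteq> None \<longrightarrow> reach G ?s bs \<noteq> None \<longrightarrow>
      ((v, as), (v, bs)) \<in> epist ?F i \<longleftrightarrow> ((?s, as), (?s, bs)) \<in> epist ?T i)"
  have info_g: "\<forall>i\<in>I. \<forall>x\<in>nodes ?F. info ?F x i = info ?T (the (?g x)) i"
    by (auto simp: nodes g inf game_tree_info)
  have epist_g: "(\<forall>i\<in>I. \<forall>x\<in>nodes ?F. \<forall>y\<in>nodes ?F.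
      (x, y) \<in> epist ?F i \<longleftrightarrow> (the (?g x), the (?g y)) \<in> epist ?T i) \<longleftrightarrow> agree"
    (is "?E \<longleftrightarrow> _")
  proof
    assume ?E
    show agree
      unfolding agree_def
    proof (intro ballI allI impI)
      fix i as bs
      assume "i \<in> I" "reach G ?s as \<noteq> None" "reach G ?s bs \<noteq> None"
      then show "((v, as), (v, bs)) \<in> epist ?F i \<longleftrightarrow> ((?s, as), (?s, bs)) \<in> epist ?T i"
        using \<open>?E\<close> nodes g by (metis option.sel)
    qed
  next
    assume agree
    then show ?E
      by (auto simp: agree_def nodes g)
  qed
  have iso: "ets_isomorphism I ?A ?F ?T ?g \<longleftrightarrow> agree"
    using dom bij stp info_g unfolding ets_isomorphism_def epist_g by blast
  show ?thesis
    unfolding iso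
  proof
    assume ni: "non_informative I ?A U ?F"
    show agree
      unfolding agree_def
    proof (intro ballI allI impI)
      fix i as bs
      assume i: "i \<in> I" and "reach G ?s as \<noteq> None" "reach G ?s bs \<noteq> None"
      then show "((v, as), (v, bs)) \<in> epist ?F i \<longleftrightarrow> ((?s, as), (?s, bs)) \<in> epist ?T i"
      \<comment> \<open>Induction from the right fits the two recursions along the last action;
        \<open>bs\<close> varies because it is shortened as well.\<close>
      proof (induction as arbitrary: bs rule: rev_induct)
        case Nil
        have "(v, v) \<in> indist M i"
          using M i assms(4) by (auto simp: epistemic_model_def equiv_def refl_on_def)
        then show ?case
          using run_model_epist_Nil[OF M i] run_model_epist_length[of v "[]" v bs G M U i]
          by (cases bs) (auto simp: game_tree_epist game_tree_nodes)
      next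
        case (snoc a as)
        show ?case
        proof (cases bs rule: rev_cases)
          case Nil
          \<comment> \<open>Sequences of different length are related on neither side.\<close>
          then show ?thesis
            using run_model_epist_length by (fastforce simp: game_tree_epist)
        next
          case bs: (snoc cs b)
          have reach: "reach G ?s (as @ [a]) \<noteq> None" "reach G ?s (cs @ [b]) \<noteq> None"
            using snoc.prems bs by auto
          then have reach': "reach G ?s as \<noteq> None" "reach G ?s cs \<noteq> None"
            by (auto dest: reach_snocD)
          \<comment> \<open>Non-informativeness in contrapositive form: after indistinguishable
            histories, equal observations force equivalent last actions. The additional conjunct of
            the run model is thus implied by the others.\<close>
          have "(a, b) \<in> U i"
            if E: "((v, as), (v, cs)) \<in> epist ?F i"
              and O: "obs G (the (reach G ?s (as @ [a]))) i = obs G (the (reach G ?s (cs @ [b]))) i"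
          proof (rule ccontr)
            assume U: "(a, b) \<notin> U i"
            have "a \<in> ?A" "b \<in> ?A"
              using reach reach_actions by fastforce+
            moreover have "((v, as), (v, as @ [a])) \<in> step ?F a" "((v, cs), (v, cs @ [b])) \<in> step ?F b"
              using reach by (auto simp: run_model_step nodes)
            ultimately have "info ?F (v, as @ [a]) i \<noteq> info ?F (v, cs @ [b]) i"
              using ni i E U reach reach' nodes unfolding non_informative_def by blast
            then show False
              using O inf i reach by simp
          qed
          then show ?thesis
            using snoc.IH[OF i reach'] reach unfolding bs run_model_epist_snoc game_tree_epist_snoc
            by (auto simp: nodes game_tree_nodes)
        qed
      qed
    qed
  next
    assume agree: agree
    show "non_informative I ?A U ?F"
      unfolding non_informative_def
    proof (intro ballI impI notI, elim conjE)
      fix w u x y a b i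
      assume n: "w \<in> nodes ?F" "u \<in> nodes ?F" "x \<in> nodes ?F" "y \<in> nodes ?F" and i: "i \<in> I"
        and U: "(a, b) \<notin> U i" and eq: "info ?F x i = info ?F y i"
        and E: "(w, x) \<in> step ?F a" "(u, y) \<in> step ?F b" "(w, u) \<in> epist ?F i"
      obtain as bs where wu: "w = (v, as)" "u = (v, bs)"
        using n by (cases w; cases u) (auto simp: nodes)
      then have xy: "x = (v, as @ [a])" "y = (v, bs @ [b])"
        using E by (cases x; cases y; auto simp: run_model_step)+
      have reach: "reach G ?s as \<noteq> None" "reach G ?s bs \<noteq> None"
        "reach G ?s (as @ [a]) \<noteq> None" "reach G ?s (bs @ [b]) \<noteq> None"
        using n wu xy by (auto simp: nodes)
      \<comment> \<open>The pair is moved to the tree, extended there by \<open>a\<close> and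
        \<open>b\<close> using equality of information alone, and moved back; the recursion of the
        run model then yields the excluded \<open>(a, b) \<in> U i\<close>.\<close>
      have "((?s, as), (?s, bs)) \<in> epist ?T i"
        using agree E(3) wu i reach unfolding agree_def by blast
      then have "((?s, as @ [a]), (?s, bs @ [b])) \<in> epist ?T i"
        unfolding game_tree_epist_snoc using eq xy i reach by (auto simp: inf game_tree_nodes)
      then have "(x, y) \<in> epist ?F i"
        using agree xy i reach unfolding agree_def by blast
      then show False
        using U unfolding xy run_model_epist_snoc by blast
    qed
  qed
qed

end
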